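(* Let $\beta>0$, $\gamma\ge0$, $\mu\ge0$. Let $\mathcal{R}^{\beta}_k\in X^{\beta}_k$, $k\in\mathbb{N}_0$, be the Sobolev orthogonal Laguerre functions such that $\mathcal{R}^{\beta}_k-l^{-1,\beta}_k\in X^{\beta}_{k-1}$ and $$A_{\gamma,\mu}(\mathcal{R}^{\beta}_k,\mathcal{R}^{\beta}_m)=\rho_k\,\delta_{k,m},\qquad k,m\in\mathbb{N}_0.$$ Then the $\mathcal{R}^{\beta}_k$ satisfy the recurrence relation $$\mathcal{R}^{\beta}_0(x)=l^{-1,\beta}_0(x),\qquad \mathcal{R}^{\beta}_k(x)=l^{-1,\beta}_k(x)-d_{k-1}\mathcal{R}^{\beta}_{k-1}(x),\quad k\ge1,$$ where $\rho_0=\mu+\dfrac{\beta}{4}+\dfrac{\gamma}{\beta}$ and $$d_{k-1}=\frac{\beta}{4\rho_{k-1}}-\frac{\gamma}{\beta\rho_{k-1}},\qquad \rho_k=-d_{k-1}^2\rho_{k-1}+\frac{\beta}{2}+\frac{2\gamma}{\beta},\qquad k\ge1.$$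
   Context: $\Lambda=(0,\infty)$, $(u,v)=\int_\Lambda uv\,dx$, $\mathbb{P}_N$ is the space of real polynomials of degree $\le N$, and $\delta_{k,m}$ is the Kronecker symbol. $X^{\beta}_N=\{e^{-\frac12\beta x}p(x):p\in\mathbb{P}_N\}$ for $N\ge0$, and $X^{\beta}_{-1}=\{0\}$. The bilinear form is $$A_{\gamma,\mu}(u,v)=\mu\,u(0)v(0)+(u',v')+\gamma(u,v),\qquad u,v\in H^1(\Lambda).$$ For $a\in\mathbb{R}$ let $(a)_n=a(a+1)\cdots(a+n-1)$, $(a)_0=1$. For $\alpha\in\mathbb{R}$, $\mathcal{L}^{\alpha}_k(x)=\sum_{\nu=0}^{k}\frac{(\alpha+\nu+1)_{k-\nu}}{(k-\nu)!\,\nu!}(-x)^{\nu}$ and $l^{\alpha,\beta}_k(x)=e^{-\frac12\beta x}\mathcal{L}^{\alpha}_k(\beta x)$, $k\ge0$; here $\alpha=-1$ is used. *)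

theory Defs
  imports "HOL-Analysis.Analysis" "HOL-Computational_Algebra.Polynomial"
begin

text \<open>
  Functions on the closed half-line are total functions on the reals of which only the values
  on \<open>[0, \<infinity>)\<close> matter. Hence membership in \<open>X_space\<close> constrains a function
  on \<open>[0, \<infinity>)\<close> only. The index is an integer so that \<open>X_space \<beta> (- 1)\<close> is
  the zero space.
\<close>

definition X_space :: "real \<Rightarrow> int \<Rightarrow> (real \<Rightarrow> real) set" where
  "X_space \<beta> N =
     (if N < 0 then {u. \<forall>x\<ge>0. u x = 0}
      else {u. \<exists>p :: real poly. int (degree p) \<le> N \<and>
                 (\<forall>x\<ge>0. u x = exp (- (1/2) * \<beta> * x) * poly p x)})"

definition L2_inner :: "(real \<Rightarrow> real) \<Rightarrow> (real \<Rightarrow> real) \<Rightarrow> real" where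
  "L2_inner u v = (LINT x:{0<..}|lebesgue. u x * v x)"

text \<open>
  An element of \<open>H\<^sup>1(0, \<infinity>)\<close> is taken as its representative that is continuous on
  \<open>[0, \<infinity>)\<close> and locally absolutely continuous: its value at 0 is the trace, and its
  pointwise derivative agrees almost everywhere with the weak one.
\<close>

definition A_form :: "real \<Rightarrow> real \<Rightarrow> (real \<Rightarrow> real) \<Rightarrow> (real \<Rightarrow> real) \<Rightarrow> real" where
  "A_form \<gamma> \<mu> u v = \<mu> * u 0 * v 0 + L2_inner (deriv u) (deriv v) + \<gamma> * L2_inner u v"

definition Laguerre :: "real \<Rightarrow> nat \<Rightarrow> real \<Rightarrow> real" where
  "Laguerre \<alpha> k x =
     (\<Sum>\<nu>=0..k. pochhammer (\<alpha> + real \<nu> + 1) (k - \<nu>) / (fact (k - \<nu>) * fact \<nu>) * (- x) ^ \<nu>)"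

definition laguerre_fun :: "real \<Rightarrow> real \<Rightarrow> nat \<Rightarrow> real \<Rightarrow> real" where
  "laguerre_fun \<alpha> \<beta> k x = exp (- (1/2) * \<beta> * x) * Laguerre \<alpha> k (\<beta> * x)"

end

theory Submission imports Defs "HOL-Probability.Sinc_Integral" begin

text \<open>
  The Gram matrix of the Laguerre functions \<open>l\<^sub>k\<close> with parameter \<open>\<alpha> = - 1\<close> in the form \<open>A\<close> is
  tridiagonal, and this is why orthogonalising them takes a two-term recurrence. Write \<open>L\<^sub>k\<close> for
  the classical Laguerre polynomials (\<open>\<alpha> = 0\<close>), which are orthonormal for the weight \<open>exp (- x)\<close>,
  and \<open>M\<^sub>k\<close> for those with \<open>\<alpha> = - 1\<close>. For \<open>k \<ge> 1\<close> one has
  \<open>M\<^sub>k = L\<^sub>k - L\<^sub>k\<^sub>-\<^sub>1\<close>, \<open>M\<^sub>k' = - L\<^sub>k\<^sub>-\<^sub>1\<close> and \<open>M\<^sub>k 0 = 0\<close>. Since the derivative of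
  \<open>exp (- x/2) p x\<close> is \<open>exp (- x/2) (p' - p/2) x\<close>, the functions \<open>l\<^sub>k\<close> and \<open>l\<^sub>k'\<close> are, up to
  constants, \<open>L\<^sub>k - L\<^sub>k\<^sub>-\<^sub>1\<close> and \<open>L\<^sub>k + L\<^sub>k\<^sub>-\<^sub>1\<close> times the exponential, and the boundary term of \<open>A\<close>
  sees \<open>l\<^sub>0\<close> only. Hence \<open>A(l\<^sub>k, l\<^sub>k) = \<beta>/2 + 2\<gamma>/\<beta>\<close>,
  \<open>A(l\<^sub>k, l\<^sub>k\<^sub>-\<^sub>1) = \<beta>/4 - \<gamma>/\<beta>\<close>, and \<open>l\<^sub>k\<close> is orthogonal to every function in
  \<open>X\<close> of index at most \<open>k - 2\<close> (lemmas \<open>poly_form_lagm_Suc\<close> and \<open>poly_form_lagm_square\<close>).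

  With \<open>d\<close> chosen so that \<open>d \<rho>\<^sub>k\<^sub>-\<^sub>1 = A(l\<^sub>k, R\<^sub>k\<^sub>-\<^sub>1)\<close>, the function \<open>R\<^sub>k - l\<^sub>k + d R\<^sub>k\<^sub>-\<^sub>1\<close> lies in
  the space of index \<open>k - 1\<close> and is orthogonal to all of it, itself included. The form \<open>A\<close> is
  positive definite on functions \<open>exp (- \<beta> x/2) p x\<close>, so this function vanishes (lemma
  \<open>recurrence\<close>). Taking \<open>A\<close> of \<open>R\<^sub>k = l\<^sub>k - d R\<^sub>k\<^sub>-\<^sub>1\<close> with itself gives the recurrence for
  \<open>\<rho>\<close>. Definiteness also gives \<open>\<rho>\<^sub>k \<noteq> 0\<close>.

  All of this is algebra of real polynomials once \<open>A\<close> is expressed through the linear functional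
  \<open>p \<mapsto> \<integral> exp (- x) p x dx\<close> on the half-line.
\<close>

section \<open>Moments of the exponential weight\<close>

definition exp_moment :: "real poly \<Rightarrow> real" where
  "exp_moment p = (\<integral>x. poly p x * exp (- x) * indicator {0<..} x \<partial>lborel)"

lemma poly_eq_sum_coeff:
  fixes p :: "real poly"
  assumes "degree p \<le> N"
  shows "poly p x = (\<Sum>i\<le>N. coeff p i * x ^ i)"
  unfolding poly_altdef using assms
  by (intro sum.mono_neutral_left) (auto intro: coeff_eq_0)

lemma has_exp_moment:
  fixes p :: "real poly"
  assumes "degree p \<le> N"
  shows "has_bochner_integral lborel (\<lambda>x. poly p x * exp (- x) * indicator {0<..} x)
           (\<Sum>i\<le>N. coeff p i * fact i)"
proof -
  have "has_bochner_integral lborel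
          (\<lambda>x::real. \<Sum>i\<le>N. coeff p i * (x ^ i * exp (- x) * indicator {0<..} x))
          (\<Sum>i\<le>N. coeff p i * fact i)"
    by (intro has_bochner_integral_sum has_bochner_integral_mult_right
          has_bochner_integral_I0i_power_exp_m)
  then show ?thesis
    by (simp add: poly_eq_sum_coeff[OF assms] sum_distrib_right mult.assoc)
qed

lemma integrable_exp_moment:
  "integrable lborel (\<lambda>x. poly p x * exp (- x) * indicator {0<..} x :: real)"
  using has_exp_moment[OF order_refl] by (rule integrable.intros)

lemma exp_moment_eq_sum:
  "degree p \<le> N \<Longrightarrow> exp_moment p = (\<Sum>i\<le>N. coeff p i * fact i)"
  unfolding exp_moment_def by (rule has_bochner_integral_integral_eq[OF has_exp_moment])

lemma exp_moment_add: "exp_moment (p + q) = exp_moment p + exp_moment q"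
  unfolding exp_moment_def
  using Bochner_Integration.integral_add[OF integrable_exp_moment[of p] integrable_exp_moment[of q]]
  by (simp add: algebra_simps)

lemma exp_moment_smult: "exp_moment (smult c p) = c * exp_moment p"
  unfolding exp_moment_def by (simp add: mult.assoc)

lemma exp_moment_minus: "exp_moment (- p) = - exp_moment p"
  using exp_moment_smult[of "- 1" p] by simp

lemma exp_moment_diff: "exp_moment (p - q) = exp_moment p - exp_moment q"
  using exp_moment_add[of p "- q"] by (simp add: exp_moment_minus)

lemmas exp_moment_linear =
  exp_moment_add exp_moment_diff exp_moment_minus exp_moment_smult

lemma exp_moment_const: "exp_moment [:c:] = c"
  using exp_moment_eq_sum[of "[:c:]" 0] by simp

text \<open>
  This is integration by parts for \<open>exp (- x) p x\<close>; on monomials it is \<open>(n + 1)! = (n + 1) n!\<close>.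
\<close>

lemma exp_moment_pderiv: "exp_moment (pderiv p) = exp_moment p - poly p 0"
proof -
  have "exp_moment p = (\<Sum>i\<le>Suc (degree p). coeff p i * fact i)"
    by (rule exp_moment_eq_sum) simp
  also have "\<dots> = coeff p 0 + (\<Sum>i\<le>degree p. coeff p (Suc i) * fact (Suc i))"
    by (subst sum.atMost_Suc_shift) simp
  also have "(\<Sum>i\<le>degree p. coeff p (Suc i) * fact (Suc i)) = exp_moment (pderiv p)"
    by (subst exp_moment_eq_sum[of _ "degree p"])
       (auto simp: coeff_pderiv degree_pderiv algebra_simps intro!: sum.cong)
  finally show ?thesis by (simp add: poly_0_coeff_0)
qed

lemma exp_moment_square_nonneg: "0 \<le> exp_moment (p * p)"
  unfolding exp_moment_def by (intro integral_nonneg_AE) (auto split: split_indicator)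

lemma exp_moment_square_eq_0:
  assumes "exp_moment (p * p) = 0"
  shows "p = 0"
proof (rule ccontr)
  assume "p \<noteq> 0"
  then have "finite {x. poly p x = 0}" by (rule poly_roots_finite)
  then have "AE x in lborel. x \<notin> {x. poly p x = 0}"
    by (intro AE_not_in) (simp add: finite_imp_null_set_lborel)
  moreover have "AE x in lborel. poly (p * p) x * exp (- x) * indicator {0<..} x = 0"
    using assms unfolding exp_moment_def
    by (subst (asm) integral_nonneg_eq_0_iff_AE[OF integrable_exp_moment])
       (auto split: split_indicator)
  \<comment> \<open>Off the finitely many roots of \<open>p\<close> the integrand is positive, so almost no point lies in
    the half-line; a bounded piece of it already has measure 1.\<close>
  ultimately have "AE x in lborel. (x::real) \<notin> {0<..<1}"
    by eventually_elim (auto split: split_indicator_asm)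
  then have "emeasure lborel {0<..<1::real} = 0"
    by (subst (asm) AE_iff_null_sets[symmetric]) auto
  then show False by simp
qed

section \<open>Laguerre polynomials\<close>

text \<open>
  The polynomials \<open>lag k\<close> are the classical Laguerre polynomials with parameter 0, and \<open>lagm k\<close>
  are those with parameter \<open>- 1\<close>, introduced by the contiguity relation
  \<open>L\<^sub>k\<^sup>-\<^sup>1 = L\<^sub>k\<^sup>0 - L\<^sub>k\<^sub>-\<^sub>1\<^sup>0\<close>; their explicit coefficients are recovered in
  \<open>poly_lagm\<close>.
\<close>

definition lag :: "nat \<Rightarrow> real poly" where
  "lag k = (\<Sum>n\<le>k. monom ((- 1) ^ n * real (k choose n) / fact n) n)"

fun lagm :: "nat \<Rightarrow> real poly" where
  "lagm 0 = lag 0"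
| "lagm (Suc k) = lag (Suc k) - lag k"

lemma coeff_lag: "coeff (lag k) n = (- 1) ^ n * real (k choose n) / fact n"
  by (auto simp: lag_def coeff_sum sum.delta)

lemma lag_0: "lag 0 = 1"
  by (simp add: lag_def)

lemma poly_lagm: "poly (lagm k) x = Laguerre (- 1) k x"
proof (cases k)
  case 0
  then show ?thesis by (simp add: lag_0 Laguerre_def)
next
  case (Suc j)
  have deg: "degree (lagm (Suc j)) \<le> Suc j"
    by (rule degree_le) (auto simp: coeff_lag binomial_eq_0)
  have "pochhammer (real n) (Suc j - n) / fact (Suc j - n) = real (Suc j choose n) - real (j choose n)"
    if "n \<le> Suc j" for n
  proof (cases n)
    case 0
    then show ?thesis by (simp add: pochhammer_0_left)
  next
    case (Suc i)
    have "fact j = fact i * pochhammer (1 + real i) (j - i)"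
      using pochhammer_product[of i j "1::real"] that Suc by (simp add: pochhammer_fact)
    then have "pochhammer (1 + real i) (j - i) = fact j / fact i"
      by (simp add: field_simps)
    then show ?thesis
      using that Suc by (simp add: binomial_fact)
  qed
  note c = this
  have "poly (lagm (Suc j)) x = (\<Sum>n\<le>Suc j. coeff (lagm (Suc j)) n * x ^ n)"
    by (rule poly_eq_sum_coeff[OF deg])
  also have "\<dots> = Laguerre (- 1) (Suc j) x"
    unfolding Laguerre_def atMost_atLeast0
  proof (rule sum.cong)
    fix n assume "n \<in> {0..Suc j}"
    then have "pochhammer (real n) (Suc j - n) / (fact (Suc j - n) * fact n) * (- x) ^ n
       = (real (Suc j choose n) - real (j choose n)) / fact n * ((- 1) ^ n * x ^ n)"
      using c[of n] by (metis atLeastAtMost_iff divide_divide_eq_left power_minus)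
    also have "\<dots> = coeff (lagm (Suc j)) n * x ^ n"
      by (simp add: coeff_lag right_diff_distrib left_diff_distrib diff_divide_distrib mult_ac)
    finally show "coeff (lagm (Suc j)) n * x ^ n =
       pochhammer (- 1 + real n + 1) (Suc j - n) / (fact (Suc j - n) * fact n) * (- x) ^ n"
      by simp
  qed simp
  finally show ?thesis using Suc by simp
qed

text \<open>
  This is Pascal's rule: the coefficients of \<open>lag (Suc k) - lag k\<close> involve
  \<open>(k + 1 choose n + 1) - (k choose n + 1) = (k choose n)\<close>.
\<close>

lemma pderiv_lagm: "pderiv (lagm (Suc k)) = - lag k"
proof (rule poly_eqI)
  fix n
  have "coeff (lagm (Suc k)) (Suc n) = - ((- 1) ^ n * real (k choose n)) / fact (Suc n)"
    by (simp only: lagm.simps coeff_diff coeff_lag binomial_Suc_Suc of_nat_add distrib_left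
          add_divide_distrib power_Suc)
  moreover have "real (Suc n) * (t / fact (Suc n)) = t / fact n" for t :: real
    by (simp del: of_nat_Suc)
  ultimately show "coeff (pderiv (lagm (Suc k))) n = coeff (- lag k) n"
    by (simp add: coeff_pderiv coeff_lag del: lagm.simps of_nat_Suc fact_Suc)
qed

lemma poly_lagm_0: "poly (lagm (Suc k)) 0 = 0"
  by (simp add: poly_0_coeff_0 coeff_lag)

text \<open>
  The condition on coefficients, unlike a bound on \<open>degree\<close>, describes the zero space for \<open>k = 0\<close>
  and is a linear condition.
\<close>

definition deg_below :: "nat \<Rightarrow> real poly \<Rightarrow> bool" where
  "deg_below k p \<longleftrightarrow> (\<forall>n\<ge>k. coeff p n = 0)"

lemma deg_below_0: "deg_below 0 p \<Longrightarrow> p = 0"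
  by (simp add: deg_below_def poly_eq_iff)

lemma deg_below_mono: "deg_below j p \<Longrightarrow> j \<le> k \<Longrightarrow> deg_below k p"
  by (simp add: deg_below_def)

lemma deg_below_pderiv: "deg_below (Suc k) p \<Longrightarrow> deg_below k (pderiv p)"
  by (simp add: deg_below_def coeff_pderiv)

lemma deg_below_lag: "deg_below (Suc k) (lag k)"
  by (simp add: deg_below_def coeff_lag)

lemma deg_below_lagm: "deg_below (Suc k) (lagm k)"
  by (cases k) (simp_all add: deg_below_def coeff_lag binomial_eq_0)

lemma deg_below_add: "deg_below k p \<Longrightarrow> deg_below k q \<Longrightarrow> deg_below k (p + q)"
  by (simp add: deg_below_def)

text \<open>
  Integrate \<open>(lagm (Suc k) * q)'\<close>: the boundary term vanishes, and \<open>lagm (Suc k)' = - lag k\<close>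
  turns the rest into an identity that trades \<open>q\<close> for \<open>q'\<close>. Both orthogonality and
  normalisation of the polynomials \<open>lag k\<close> follow from it, by lowering the degree of \<open>q\<close>.
\<close>

lemma exp_moment_lag_Suc:
  "exp_moment (lag (Suc k) * q) = exp_moment (lag (Suc k) * pderiv q) - exp_moment (lag k * pderiv q)"
proof -
  have "exp_moment (pderiv (lagm (Suc k) * q)) = exp_moment (lagm (Suc k) * q)"
    by (simp add: exp_moment_pderiv poly_lagm_0 del: lagm.simps)
  moreover have "pderiv (lagm (Suc k) * q) = lagm (Suc k) * pderiv q - lag k * q"
    by (simp add: pderiv_mult pderiv_lagm del: lagm.simps)
  ultimately show ?thesis
    by (simp add: exp_moment_linear left_diff_distrib)
qed

lemma exp_moment_lag_orthogonal:
  "deg_below k q \<Longrightarrow> exp_moment (lag k * q) = 0"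
proof (induction k arbitrary: q)
  case 0
  then have "q = 0" by (rule deg_below_0)
  then show ?case using exp_moment_smult[of 0 0] by simp
next
  case (Suc k)
  \<comment> \<open>The term with \<open>lag (Suc k)\<close> keeps its index and only lowers the degree of \<open>q\<close>, hence an
    inner induction on that degree.\<close>
  have "deg_below j q \<Longrightarrow> j \<le> Suc k \<Longrightarrow> exp_moment (lag (Suc k) * q) = 0" for j
  proof (induction j arbitrary: q)
    case 0
    then have "q = 0" by (simp add: deg_below_0)
    then show ?case using exp_moment_smult[of 0 0] by simp
  next
    case (Suc j)
    have q': "deg_below j (pderiv q)"
      using Suc.prems by (simp add: deg_below_pderiv)
    have "exp_moment (lag k * pderiv q) = 0"
      using \<open>\<And>q. deg_below k q \<Longrightarrow> exp_moment (lag k * q) = 0\<close> deg_below_mono[OF q', of k] Suc.prems by simp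
    then show ?case
      using Suc.IH[OF q'] Suc.prems exp_moment_lag_Suc[of k q] by simp
  qed
  then show ?case using Suc.prems by blast
qed

text \<open>
  In \<open>exp_moment_lag_Suc\<close> with \<open>q = lag (Suc k)\<close> one has \<open>q' = (lag k)' - lag k\<close>, and by
  orthogonality only the product of \<open>lag k\<close> with \<open>- lag k\<close> survives.
\<close>

lemma exp_moment_lag_square: "exp_moment (lag k * lag k) = 1"
proof (induction k)
  case 0
  then show ?case by (simp add: lag_0 exp_moment_const one_pCons)
next
  case (Suc k)
  have d: "pderiv (lag (Suc k)) = pderiv (lag k) - lag k"
    using pderiv_lagm[of k] by (simp add: pderiv_diff algebra_simps)
  show ?case
    using Suc exp_moment_lag_orthogonal[OF deg_below_pderiv[OF deg_below_lag[of k]]]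
      exp_moment_lag_orthogonal[OF deg_below_pderiv[OF deg_below_lag[of "Suc k"]]]
    by (subst exp_moment_lag_Suc) (simp add: d right_diff_distrib exp_moment_linear)
qed

text \<open>
  Against \<open>lag k\<close> only the leading term counts, and \<open>lagm k\<close> shares it with \<open>lag k\<close>.
\<close>

lemma exp_moment_lag_leading:
  assumes "deg_below k (p - lagm k)"
  shows "exp_moment (lag k * p) = 1"
proof -
  have "deg_below k (p - lag k)"
  proof (cases k)
    case (Suc j)
    then show ?thesis
      using assms deg_below_lag[of j] by (simp add: deg_below_def)
  qed (use assms in simp)
  then have "exp_moment (lag k * (p - lag k)) = 0" by (rule exp_moment_lag_orthogonal)
  then show ?thesis by (simp add: right_diff_distrib exp_moment_linear exp_moment_lag_square)
qed

section \<open>The Sobolev form on polynomials\<close>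

text \<open>
  \<open>weighted_deriv p\<close> is the polynomial factor of the derivative of \<open>exp (- x/2) p x\<close>.
\<close>

definition weighted_deriv :: "real poly \<Rightarrow> real poly" where
  "weighted_deriv p = pderiv p - smult (1/2) p"

text \<open>
  This is the form \<open>A\<close> evaluated at \<open>exp (- \<beta> x/2) p (\<beta> x)\<close> and
  \<open>exp (- \<beta> x/2) q (\<beta> x)\<close>, see \<open>A_form_weighted\<close>. Rescaling the argument by \<open>\<beta>\<close> leaves
  the weight \<open>exp (- x)\<close>, free of \<open>\<beta>\<close>; each derivative contributes a factor \<open>\<beta>\<close> and the
  substitution a factor \<open>1/\<beta>\<close>.
\<close>

definition poly_form :: "real \<Rightarrow> real \<Rightarrow> real \<Rightarrow> real poly \<Rightarrow> real poly \<Rightarrow> real" where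
  "poly_form \<beta> \<gamma> \<mu> p q = \<mu> * poly p 0 * poly q 0
     + \<beta> * exp_moment (weighted_deriv p * weighted_deriv q) + \<gamma> / \<beta> * exp_moment (p * q)"

lemma weighted_deriv_linear:
  "weighted_deriv (p + q) = weighted_deriv p + weighted_deriv q"
  "weighted_deriv (p - q) = weighted_deriv p - weighted_deriv q"
  "weighted_deriv (smult c p) = smult c (weighted_deriv p)"
  by (simp_all add: weighted_deriv_def pderiv_add pderiv_diff pderiv_smult smult_add_right
      smult_diff_right mult.commute)

lemma poly_form_commute: "poly_form \<beta> \<gamma> \<mu> p q = poly_form \<beta> \<gamma> \<mu> q p"
  by (simp add: poly_form_def mult_ac)

lemma poly_form_linear:
  "poly_form \<beta> \<gamma> \<mu> (p + q) r = poly_form \<beta> \<gamma> \<mu> p r + poly_form \<beta> \<gamma> \<mu> q r"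
  "poly_form \<beta> \<gamma> \<mu> (p - q) r = poly_form \<beta> \<gamma> \<mu> p r - poly_form \<beta> \<gamma> \<mu> q r"
  "poly_form \<beta> \<gamma> \<mu> (smult c p) r = c * poly_form \<beta> \<gamma> \<mu> p r"
  by (simp_all add: poly_form_def weighted_deriv_linear distrib_right left_diff_distrib
      exp_moment_linear, simp_all add: algebra_simps add_divide_distrib diff_divide_distrib)

lemma poly_form_linear_right:
  "poly_form \<beta> \<gamma> \<mu> r (p + q) = poly_form \<beta> \<gamma> \<mu> r p + poly_form \<beta> \<gamma> \<mu> r q"
  "poly_form \<beta> \<gamma> \<mu> r (p - q) = poly_form \<beta> \<gamma> \<mu> r p - poly_form \<beta> \<gamma> \<mu> r q"
  "poly_form \<beta> \<gamma> \<mu> r (smult c p) = c * poly_form \<beta> \<gamma> \<mu> r p"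
  by (simp_all add: poly_form_commute[of _ _ _ r] poly_form_linear)

text \<open>
  The derivative term alone is definite: \<open>p' = p/2\<close> has no polynomial solution except 0, by
  comparing leading coefficients. This covers the case \<open>\<gamma> = \<mu> = 0\<close>.
\<close>

lemma poly_form_definite:
  assumes "\<beta> > 0" "\<gamma> \<ge> 0" "\<mu> \<ge> 0" "poly_form \<beta> \<gamma> \<mu> p p = 0"
  shows "p = 0"
proof (rule ccontr)
  assume "p \<noteq> 0"
  have "0 \<le> \<mu> * poly p 0 * poly p 0" "0 \<le> \<gamma> / \<beta> * exp_moment (p * p)"
    using assms(1-3) by (simp_all add: exp_moment_square_nonneg mult.assoc)
  then have "\<beta> * exp_moment (weighted_deriv p * weighted_deriv p) \<le> 0"
    using assms(4) by (simp add: poly_form_def)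
  then have "exp_moment (weighted_deriv p * weighted_deriv p) = 0"
    using \<open>\<beta> > 0\<close> exp_moment_square_nonneg[of "weighted_deriv p"] by (simp add: mult_le_0_iff)
  then have "weighted_deriv p = 0" by (rule exp_moment_square_eq_0)
  then have "coeff (weighted_deriv p) (degree p) = 0" by simp
  then show False
    using \<open>p \<noteq> 0\<close> by (simp add: weighted_deriv_def coeff_pderiv coeff_eq_0)
qed

lemma weighted_deriv_lagm_Suc: "weighted_deriv (lagm (Suc k)) = smult (- 1/2) (lag k + lag (Suc k))"
  unfolding weighted_deriv_def pderiv_lagm
  by (rule poly_eqI) (simp add: algebra_simps)

text \<open>
  This contains the off-diagonal part of the tridiagonal Gram matrix. The polynomials \<open>lag k\<close>
  and \<open>lag (Suc k)\<close> that make up \<open>lagm (Suc k)\<close> and its weighted derivative annihilate \<open>p'\<close>,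
  and \<open>lag (Suc k)\<close> annihilates \<open>p\<close>. Only the pairing of \<open>lag k\<close> with \<open>p\<close> remains; it
  vanishes if \<open>p\<close> has degree less than \<open>k\<close> and otherwise picks out the leading coefficient.
\<close>

lemma poly_form_lagm_Suc:
  assumes "deg_below (Suc k) p"
  shows "poly_form \<beta> \<gamma> \<mu> (lagm (Suc k)) p = (\<beta> / 4 - \<gamma> / \<beta>) * exp_moment (lag k * p)"
proof -
  have p': "deg_below k (pderiv p)" using assms by (rule deg_below_pderiv)
  have "exp_moment (lag k * pderiv p) = 0" "exp_moment (lag (Suc k) * pderiv p) = 0"
    "exp_moment (lag (Suc k) * p) = 0"
    using p' assms by (auto intro!: exp_moment_lag_orthogonal intro: deg_below_mono)
  then have "exp_moment (weighted_deriv (lagm (Suc k)) * weighted_deriv p) = exp_moment (lag k * p) / 4"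
    unfolding weighted_deriv_lagm_Suc
    by (simp add: weighted_deriv_def exp_moment_linear distrib_right right_diff_distrib del: smult_add_right smult_minus_left)
  moreover have "exp_moment (lagm (Suc k) * p) = - exp_moment (lag k * p)"
    using \<open>exp_moment (lag (Suc k) * p) = 0\<close> by (simp add: left_diff_distrib exp_moment_linear)
  ultimately show ?thesis
    by (simp add: poly_form_def poly_lagm_0 left_diff_distrib del: lagm.simps)
qed

lemma poly_form_lagm_square:
  "poly_form \<beta> \<gamma> \<mu> (lagm (Suc k)) (lagm (Suc k)) = \<beta> / 2 + 2 * \<gamma> / \<beta>"
proof -
  have o: "exp_moment (lag (Suc k) * lag k) = 0" "exp_moment (lag k * lag (Suc k)) = 0"
    using exp_moment_lag_orthogonal[OF deg_below_lag] by (simp_all add: mult.commute)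
  have "exp_moment (weighted_deriv (lagm (Suc k)) * weighted_deriv (lagm (Suc k))) = 1 / 2"
    unfolding weighted_deriv_lagm_Suc
    by (simp add: exp_moment_linear distrib_left distrib_right o exp_moment_lag_square
        del: smult_add_right smult_minus_left)
  moreover have "exp_moment (lagm (Suc k) * lagm (Suc k)) = 2"
    by (simp only: lagm.simps left_diff_distrib right_diff_distrib exp_moment_linear o
        exp_moment_lag_square)
  ultimately show ?thesis
    by (simp only: poly_form_def poly_lagm_0)
qed

lemma poly_form_lagm_0: "poly_form \<beta> \<gamma> \<mu> (lagm 0) (lagm 0) = \<mu> + \<beta> / 4 + \<gamma> / \<beta>"
  by (simp add: poly_form_def lag_0 weighted_deriv_def exp_moment_linear exp_moment_const one_pCons)

section \<open>Orthogonal polynomials of the Sobolev form\<close>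

locale sobolev_orthogonal =
  fixes \<beta> \<gamma> \<mu> :: real and P :: "nat \<Rightarrow> real poly" and \<rho> :: "nat \<Rightarrow> real"
  assumes \<beta>_pos: "\<beta> > 0" and \<gamma>_nonneg: "\<gamma> \<ge> 0" and \<mu>_nonneg: "\<mu> \<ge> 0"
    and leading: "\<And>k. deg_below k (P k - lagm k)"
    and orthogonal: "\<And>k m. poly_form \<beta> \<gamma> \<mu> (P k) (P m) = \<rho> k * (if k = m then 1 else 0)"
begin

abbreviation "B \<equiv> poly_form \<beta> \<gamma> \<mu>"

lemma P_0: "P 0 = lagm 0"
  using deg_below_0[OF leading[of 0]] by simp

lemma deg_below_P: "deg_below (Suc k) (P k)"
  using deg_below_add[OF deg_below_mono[OF leading[of k]] deg_below_lagm[of k]]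
  by (simp del: lagm.simps)

lemma coeff_P: "coeff (P k) k \<noteq> 0"
proof -
  have "coeff (P k) k = coeff (lagm k) k"
    using leading[of k] by (simp add: deg_below_def)
  also have "\<dots> \<noteq> 0" by (cases k) (simp_all add: coeff_lag binomial_eq_0)
  finally show ?thesis .
qed

lemma norm_nonzero: "\<rho> k \<noteq> 0"
proof
  assume "\<rho> k = 0"
  then have "P k = 0"
    using poly_form_definite[OF \<beta>_pos \<gamma>_nonneg \<mu>_nonneg, of "P k"] orthogonal[of k k] by simp
  then show False using coeff_P[of k] by simp
qed

lemma split_leading:
  assumes "deg_below (Suc k) p"
  obtains c r where "p = smult c (P k) + r" "deg_below k r"
proof
  let ?c = "coeff p k / coeff (P k) k"
  show "p = smult ?c (P k) + (p - smult ?c (P k))" by simp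
  show "deg_below k (p - smult ?c (P k))"
    unfolding deg_below_def
  proof (intro allI impI)
    fix n assume "k \<le> n"
    then show "coeff (p - smult ?c (P k)) n = 0"
      using assms deg_below_P[of k] coeff_P[of k]
      by (cases "n = k") (auto simp: deg_below_def)
  qed
qed

lemma P_orthogonal_below: "deg_below j p \<Longrightarrow> j \<le> k \<Longrightarrow> B (P k) p = 0"
proof (induction j arbitrary: p)
  case 0
  then have "p = smult 0 0" by (simp add: deg_below_0)
  then show ?case using poly_form_linear_right(3)[of _ _ _ _ 0 0] by simp
next
  case (Suc j)
  from Suc.prems(1) obtain c r where "p = smult c (P j) + r" "deg_below j r"
    by (rule split_leading)
  then show ?case
    using Suc by (simp add: poly_form_linear_right orthogonal)
qed

definition d :: "nat \<Rightarrow> real" where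
  "d k = \<beta> / (4 * \<rho> k) - \<gamma> / (\<beta> * \<rho> k)"

lemma d_norm: "d k * \<rho> k = \<beta> / 4 - \<gamma> / \<beta>"
  using norm_nonzero[of k] \<beta>_pos by (simp add: d_def field_simps)

lemma form_lagm_P: "B (lagm (Suc k)) (P k) = d k * \<rho> k"
  by (simp add: poly_form_lagm_Suc[OF deg_below_P] exp_moment_lag_leading[OF leading] d_norm
      del: lagm.simps)

text \<open>
  The defect \<open>D\<close> of the recurrence has degree at most \<open>k\<close>. It is orthogonal to \<open>P k\<close> by the
  choice of \<open>d k\<close>, and to everything of lower degree because each of its three terms is. So
  it is orthogonal to itself, and definiteness applies.
\<close>

lemma recurrence: "P (Suc k) = lagm (Suc k) - smult (d k) (P k)"
proof -
  define D where "D = P (Suc k) - lagm (Suc k) + smult (d k) (P k)"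
  have D_below: "deg_below (Suc k) D"
    using leading[of "Suc k"] deg_below_P[of k] by (simp add: D_def deg_below_def del: lagm.simps)
  then obtain c r where cr: "D = smult c (P k) + r" "deg_below k r"
    by (rule split_leading)
  have "B D (P k) = 0"
    using orthogonal[of "Suc k" k] orthogonal[of k k]
    by (simp add: D_def poly_form_linear form_lagm_P del: lagm.simps)
  moreover have "B D r = 0"
  proof -
    have "B (lagm (Suc k)) r = 0"
      using cr(2) by (subst poly_form_lagm_Suc)
        (auto simp: exp_moment_lag_orthogonal intro: deg_below_mono)
    then show ?thesis
      using P_orthogonal_below[OF cr(2), of k] P_orthogonal_below[OF cr(2), of "Suc k"]
      by (simp add: D_def poly_form_linear del: lagm.simps)
  qed
  ultimately have "B D D = 0"
    by (subst (2) cr(1)) (simp add: poly_form_linear_right)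
  then have "D = 0"
    by (rule poly_form_definite[OF \<beta>_pos \<gamma>_nonneg \<mu>_nonneg])
  then show ?thesis by (simp add: D_def algebra_simps del: lagm.simps)
qed

lemma norm_recurrence: "\<rho> (Suc k) = - (d k)\<^sup>2 * \<rho> k + \<beta> / 2 + 2 * \<gamma> / \<beta>"
proof -
  have "\<rho> (Suc k) = B (P (Suc k)) (P (Suc k))" by (simp add: orthogonal)
  also have "\<dots> = B (lagm (Suc k)) (lagm (Suc k)) - 2 * d k * B (lagm (Suc k)) (P k)
      + (d k)\<^sup>2 * B (P k) (P k)"
    by (simp add: recurrence poly_form_linear poly_form_linear_right
        poly_form_commute[of _ _ _ "P k" "lagm (Suc k)"] power2_eq_square algebra_simps
        del: lagm.simps)
  also have "\<dots> = \<beta> / 2 + 2 * \<gamma> / \<beta> - (d k)\<^sup>2 * \<rho> k"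
    by (simp only: poly_form_lagm_square form_lagm_P orthogonal) (simp add: power2_eq_square)
  finally show ?thesis by simp
qed

lemma norm_0: "\<rho> 0 = \<mu> + \<beta> / 4 + \<gamma> / \<beta>"
  using orthogonal[of 0 0] by (simp add: P_0 poly_form_lagm_0 del: lagm.simps)

end

section \<open>From functions on the half-line to polynomials\<close>

definition weighted :: "real \<Rightarrow> real poly \<Rightarrow> real \<Rightarrow> real" where
  "weighted \<beta> p x = exp (- (1/2) * \<beta> * x) * poly p (\<beta> * x)"

lemma L2_inner_weighted:
  assumes "\<beta> > 0"
    and u: "\<And>x. x > 0 \<Longrightarrow> u x = weighted \<beta> p x" and v: "\<And>x. x > 0 \<Longrightarrow> v x = weighted \<beta> q x"
  shows "L2_inner u v = exp_moment (p * q) / \<beta>"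
proof -
  define g where "g y = poly (p * q) y * exp (- y) * indicator {0<..} y" for y :: real
  have [measurable]: "g \<in> borel_measurable borel"
    using borel_measurable_integrable[OF integrable_exp_moment[of "p * q"]] by (simp add: g_def[abs_def])
  have ev: "exp (- (\<beta> * x)) = exp (- (\<beta> * x / 2)) * exp (- (\<beta> * x / 2))" for x
    by (simp add: exp_add[symmetric])
  have "L2_inner u v = (\<integral>x. g (\<beta> * x) \<partial>lebesgue)"
    unfolding L2_inner_def set_lebesgue_integral_def
    using assms(1) u v
    by (intro Bochner_Integration.integral_cong)
       (auto simp: g_def weighted_def zero_less_mult_iff ev split: split_indicator)
  also have "\<dots> = (\<integral>x. g (\<beta> * x) \<partial>lborel)"
    by (rule integral_completion) measurable
  also have "\<dots> = (\<integral>x. g x \<partial>lborel) / \<beta>"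
    using lborel_integral_real_affine[of \<beta> g 0] assms(1) by simp
  finally show ?thesis by (simp add: exp_moment_def g_def)
qed

text \<open>
  The values of \<open>u\<close> outside the half-line are arbitrary; since the open half-line is a
  neighbourhood of each of its points, they do not affect the derivative there.
\<close>

lemma deriv_weighted:
  assumes u: "\<And>x. x > 0 \<Longrightarrow> u x = weighted \<beta> p x" and "x > 0"
  shows "deriv u x = weighted \<beta> (smult \<beta> (weighted_deriv p)) x"
proof -
  have "(weighted \<beta> p has_field_derivative weighted \<beta> (smult \<beta> (weighted_deriv p)) x) (at x)"
    unfolding weighted_def weighted_deriv_def
    by (auto intro!: derivative_eq_intros simp: algebra_simps)
  then have "(u has_field_derivative weighted \<beta> (smult \<beta> (weighted_deriv p)) x) (at x)"
    using assms by (rule_tac has_field_derivative_transform_within_open[where S = "{0<..}"]) auto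
  then show ?thesis by (rule DERIV_imp_deriv)
qed

lemma A_form_weighted:
  assumes "\<beta> > 0"
    and u: "\<And>x. x \<ge> 0 \<Longrightarrow> u x = weighted \<beta> p x" and v: "\<And>x. x \<ge> 0 \<Longrightarrow> v x = weighted \<beta> q x"
  shows "A_form \<gamma> \<mu> u v = poly_form \<beta> \<gamma> \<mu> p q"
proof -
  have "L2_inner u v = exp_moment (p * q) / \<beta>"
    by (intro L2_inner_weighted[OF \<open>\<beta> > 0\<close>]) (simp_all add: u v)
  moreover have "L2_inner (deriv u) (deriv v)
      = exp_moment (smult \<beta> (weighted_deriv p) * smult \<beta> (weighted_deriv q)) / \<beta>"
    by (intro L2_inner_weighted[OF \<open>\<beta> > 0\<close>] deriv_weighted) (simp_all add: u v)
  ultimately show ?thesis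
    using \<open>\<beta> > 0\<close> u[of 0] v[of 0]
    by (simp add: A_form_def poly_form_def weighted_def exp_moment_linear)
qed

text \<open>
  The shift of the index makes \<open>k = 0\<close> the zero space, so that a member is described by
  \<open>deg_below k\<close> for every natural number \<open>k\<close>.
\<close>

lemma X_space_weighted:
  assumes "\<beta> > 0" "u \<in> X_space \<beta> (int k - 1)"
  obtains p where "deg_below k p" "\<And>x. x \<ge> 0 \<Longrightarrow> u x = weighted \<beta> p x"
proof (cases k)
  case 0
  with assms have "\<And>x. x \<ge> 0 \<Longrightarrow> u x = weighted \<beta> 0 x"
    by (simp add: X_space_def weighted_def)
  with that[of 0] show ?thesis by (simp add: deg_below_def)
next
  case (Suc j)
  with assms(2) obtain p where p: "degree p \<le> j"
      "\<And>x. x \<ge> 0 \<Longrightarrow> u x = exp (- (1/2) * \<beta> * x) * poly p x"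
    by (auto simp: X_space_def)
  define q where "q = pcompose p [:0, 1 / \<beta>:]"
  have "degree q \<le> j"
    using p(1) degree_pcompose[of p "[:0, 1 / \<beta>:]"] assms(1) by (simp add: q_def)
  then have "deg_below k q"
    using Suc by (auto simp: deg_below_def intro: coeff_eq_0)
  moreover have "u x = weighted \<beta> q x" if "x \<ge> 0" for x
    using p(2)[OF that] assms(1) by (simp add: weighted_def q_def poly_pcompose)
  ultimately show ?thesis by (rule that)
qed

theorem lemma1:
  fixes \<beta> \<gamma> \<mu> :: real
    and R :: "nat \<Rightarrow> real \<Rightarrow> real"
    and \<rho> :: "nat \<Rightarrow> real"
  assumes "\<beta> > 0" and "\<gamma> \<ge> 0" and "\<mu> \<ge> 0"
    and "\<And>k. R k \<in> X_space \<beta> (int k)"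
    and "\<And>k. (\<lambda>x. R k x - laguerre_fun (- 1) \<beta> k x) \<in> X_space \<beta> (int k - 1)"
    and "\<And>k m. A_form \<gamma> \<mu> (R k) (R m) = \<rho> k * (if k = m then 1 else 0)"
  shows "\<exists>d :: nat \<Rightarrow> real.
           (\<forall>x\<ge>0. R 0 x = laguerre_fun (- 1) \<beta> 0 x) \<and>
           (\<forall>k\<ge>1. \<forall>x\<ge>0. R k x = laguerre_fun (- 1) \<beta> k x - d (k - 1) * R (k - 1) x) \<and>
           \<rho> 0 = \<mu> + \<beta> / 4 + \<gamma> / \<beta> \<and>
           (\<forall>k. \<rho> k \<noteq> 0) \<and>
           (\<forall>k\<ge>1. d (k - 1) = \<beta> / (4 * \<rho> (k - 1)) - \<gamma> / (\<beta> * \<rho> (k - 1))) \<and>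
           (\<forall>k\<ge>1. \<rho> k = - (d (k - 1))\<^sup>2 * \<rho> (k - 1) + \<beta> / 2 + 2 * \<gamma> / \<beta>)"
proof -
  note \<beta> = \<open>\<beta> > 0\<close>
  have "\<exists>q. deg_below k q \<and> (\<forall>x\<ge>0. R k x - laguerre_fun (- 1) \<beta> k x = weighted \<beta> q x)" for k
    using X_space_weighted[OF \<beta> assms(5)[of k]] by metis
  then obtain Q where Q: "\<And>k. deg_below k (Q k)"
      "\<And>k x. x \<ge> 0 \<Longrightarrow> R k x - laguerre_fun (- 1) \<beta> k x = weighted \<beta> (Q k) x"
    by metis
  \<comment> \<open>The polynomial factor of \<open>R k\<close>, after rescaling its argument by \<open>\<beta>\<close>.\<close>
  define P where "P k = lagm k + Q k" for k
  have lag: "laguerre_fun (- 1) \<beta> k x = weighted \<beta> (lagm k) x" for k x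
    by (simp add: laguerre_fun_def weighted_def poly_lagm)
  have R: "R k x = weighted \<beta> (P k) x" if "x \<ge> 0" for k x
    using Q(2)[OF that, of k] by (simp add: lag P_def weighted_def algebra_simps)
  interpret sobolev_orthogonal \<beta> \<gamma> \<mu> P \<rho>
  proof
    fix k m
    show "deg_below k (P k - lagm k)" by (simp add: P_def Q(1))
    show "poly_form \<beta> \<gamma> \<mu> (P k) (P m) = \<rho> k * (if k = m then 1 else 0)"
      using A_form_weighted[OF \<beta> R R] assms(6)[of k m] by simp
  qed fact+
  have step: "R (Suc j) x = laguerre_fun (- 1) \<beta> (Suc j) x - d j * R j x" if "x \<ge> 0" for j x
    using that by (simp add: R lag recurrence weighted_def algebra_simps del: lagm.simps)
  show ?thesis
  proof (intro exI[of _ d] conjI allI impI)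
    fix x :: real assume "x \<ge> 0"
    then show "R 0 x = laguerre_fun (- 1) \<beta> 0 x" by (simp add: R lag P_0 del: lagm.simps)
  next
    fix k :: nat and x :: real assume "1 \<le> k" "0 \<le> x"
    then show "R k x = laguerre_fun (- 1) \<beta> k x - d (k - 1) * R (k - 1) x"
      using step[of x "k - 1"] by simp
  next
    fix k :: nat assume "1 \<le> k"
    then show "\<rho> k = - (d (k - 1))\<^sup>2 * \<rho> (k - 1) + \<beta> / 2 + 2 * \<gamma> / \<beta>"
      using norm_recurrence[of "k - 1"] by simp
  qed (rule norm_0 norm_nonzero d_def)+
qed

end
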